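(* Let $0\le k<\infty$, $0<q<1$, $0\le\alpha<1$, and let $f(z)=z-\sum_{m=2}^\infty a_mz^m\in k\text{-}\widetilde{ST}^{-}_q(\alpha)$. Then $$r-\frac{q(1-\alpha)}{(q^2+1)(k+1)-q(k+\alpha)}r^2\le|f(z)|\le r+\frac{q(1-\alpha)}{(q^2+1)(k+1)-q(k+\alpha)}r^2$$ for $|z|=r<1$, and $$|z|+\sum_{m=2}^\infty a_m|z|^m\le d(f(0),\partial f(\mathbb{D}))$$ for $|z|\le r^*$, where $$r^*=\frac{-1+\sqrt{1+4\left(\frac{q(1-\alpha)}{(q^2+1)(k+1)-q(k+\alpha)}\right)\left(1-\frac{q(1-\alpha)}{(q^2+1)(k+1)-q(k+\alpha)}\right)}}{2\left(\frac{q(1-\alpha)}{(q^2+1)(k+1)-q(k+\alpha)}\right)}.$$ The radius $r^*$ is the Bohr radius of the class (the largest radius for which the last inequality holds for all its members), and it is obtained for $f(z)=z-\frac{q(1-\alpha)}{(q^2+1)(k+1)-q(k+\alpha)}z^2$.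
   Context: $\mathbb{D}=\{z\in\mathbb{C}:|z|<1\}$; $d(f(0),\partial f(\mathbb{D}))$ is the Euclidean distance from $f(0)$ to the boundary of $f(\mathbb{D})$. For $0<q<1$ put $[\widetilde m]_q=\frac{q^m-q^{-m}}{q-q^{-1}}$. For an analytic function $f(z)=z-\sum_{m=2}^\infty a_mz^m$ on $\mathbb{D}$, the symmetric $q$-derivative is $(\widetilde D_qf)(z)=\frac{f(qz)-f(q^{-1}z)}{(q-q^{-1})z}$ for $z\ne0$ and $(\widetilde D_qf)(0)=f'(0)$, that is, $(\widetilde D_qf)(z)=1-\sum_{m=2}^\infty[\widetilde m]_qa_mz^{m-1}$, understood through this power series, which is required to converge on $\mathbb{D}$. The class $k\text{-}\widetilde{ST}^{-}_q(\alpha)$ consists of the analytic functions $f(z)=z-\sum_{m=2}^\infty a_mz^m$ on $\mathbb{D}$ with all $a_m\ge0$ such that $p(z)=z(\widetilde D_qf)(z)/f(z)$ (well defined on $\mathbb{D}$, with value $1$ at $0$) satisfies $\Re(p(z))>k|p(z)-1|+\alpha$ for all $z\in\mathbb{D}$. *)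

theory Defs
  imports "HOL-Complex_Analysis.Complex_Analysis"
begin

definition sym_q_number :: "real \<Rightarrow> nat \<Rightarrow> real" where
  "sym_q_number q m = (q ^ m - inverse q ^ m) / (q - inverse q)"

text \<open>\<open>has_neg_expansion f a\<close> says that \<open>f(z) = z - a\<^sub>2 z\<^sup>2 - a\<^sub>3 z\<^sup>3 - \<dots>\<close> on the open unit disc.
  The values \<open>a 0\<close> and \<open>a 1\<close> are never used; the values \<open>a m\<close> for \<open>m \<ge> 2\<close> are
  determined by \<open>f\<close>. Values of \<open>f\<close> outside the disc play no role anywhere.\<close>

definition has_neg_expansion :: "(complex \<Rightarrow> complex) \<Rightarrow> (nat \<Rightarrow> real) \<Rightarrow> bool" where
  "has_neg_expansion f a \<longleftrightarrow>
     (\<forall>z\<in>ball 0 1. (\<lambda>m. of_real (a (m + 2)) * z ^ (m + 2)) sums (z - f z))"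

text \<open>The symmetric \<open>q\<close>-derivative of \<open>f(z) = z - a\<^sub>2 z\<^sup>2 - a\<^sub>3 z\<^sup>3 - \<dots>\<close> is given through its power
  series, because \<open>z / q\<close> may lie outside the disc on which \<open>f\<close> is defined. Lemma
  \<open>sym_q_deriv_eq_quotient\<close> below recovers the difference quotient.\<close>

definition sym_q_deriv :: "real \<Rightarrow> (nat \<Rightarrow> real) \<Rightarrow> complex \<Rightarrow> complex" where
  "sym_q_deriv q a z = 1 - (\<Sum>m. of_real (sym_q_number q (m + 2) * a (m + 2)) * z ^ (m + 1))"

definition sym_q_deriv_converges :: "real \<Rightarrow> (nat \<Rightarrow> real) \<Rightarrow> bool" where
  "sym_q_deriv_converges q a \<longleftrightarrow>
     (\<forall>z\<in>ball 0 1. summable (\<lambda>m. of_real (sym_q_number q (m + 2) * a (m + 2)) * z ^ (m + 1) :: complex))"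

lemma sym_q_deriv_eq_quotient:
  fixes q :: real and z :: complex
  assumes q: "0 < q" "q < 1"
    and exp: "has_neg_expansion f a" and conv: "sym_q_deriv_converges q a"
    and z: "z \<in> ball 0 1" "z \<noteq> 0"
  defines "F \<equiv> \<lambda>w. w - (\<Sum>m. of_real (a (m + 2)) * w ^ (m + 2))"
  shows "summable (\<lambda>m. of_real (a (m + 2)) * (z / of_real q) ^ (m + 2))"
    and "F (of_real q * z) = f (of_real q * z)"
    and "sym_q_deriv q a z =
      (F (of_real q * z) - F (z / of_real q)) / (of_real (q - inverse q) * z)"
proof -
  let ?c = "of_real (q - inverse q) * z :: complex"
  let ?d = "\<lambda>m. of_real (sym_q_number q (m + 2) * a (m + 2)) * z ^ (m + 1) :: complex"
  let ?u = "\<lambda>m. of_real (a (m + 2)) * (of_real q * z) ^ (m + 2)"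
  let ?v = "\<lambda>m. of_real (a (m + 2)) * (z / of_real q) ^ (m + 2)"
  have "inverse q > 1" using q by (simp add: one_less_inverse)
  then have nz: "q - inverse q \<noteq> 0" using q by linarith
  have "norm (of_real q * z) < 1" 
    using q z mult_strict_mono'[of q 1 "norm z" 1] by (simp add: norm_mult)
  then have u: "?u sums (of_real q * z - f (of_real q * z))"
    using exp unfolding has_neg_expansion_def by (simp add: norm_mult)
  have d: "summable ?d" using conv z(1) unfolding sym_q_deriv_converges_def by blast
  have v_eq: "?v m = ?u m - ?c * ?d m" for m
  proof -
    have "sym_q_number q (m + 2) * (q - inverse q) = q ^ (m + 2) - inverse q ^ (m + 2)"
      using nz by (simp add: sym_q_number_def)
    then have "(of_real (sym_q_number q (m + 2)) * of_real (q - inverse q) :: complex)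
        = of_real q ^ (m + 2) - inverse (of_real q) ^ (m + 2)"
      by (metis of_real_mult of_real_diff of_real_power of_real_inverse)
    moreover have "?c * ?d m = (of_real (sym_q_number q (m + 2)) * of_real (q - inverse q))
        * (of_real (a (m + 2)) * z ^ (m + 2))"
      by (simp add: algebra_simps)
    ultimately show ?thesis
      by (simp only:) (simp add: power_mult_distrib divide_inverse algebra_simps)
  qed
  have v: "?v sums (of_real q * z - f (of_real q * z) - ?c * (\<Sum>m. ?d m))"
    unfolding v_eq using u d by (intro sums_diff sums_mult summable_sums)
  show "summable ?v" using v by (rule sums_summable)
  show F: "F (of_real q * z) = f (of_real q * z)"
    unfolding F_def sums_unique[OF u, symmetric] by simp
  have "F (z / of_real q) = z / of_real q - (of_real q * z - f (of_real q * z) - ?c * (\<Sum>m. ?d m))"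
    unfolding F_def sums_unique[OF v, symmetric] by (rule refl)
  then have "F (of_real q * z) - F (z / of_real q) = ?c * (1 - (\<Sum>m. ?d m))"
    using F by (simp add: divide_inverse algebra_simps)
  moreover have "?c \<noteq> 0" using nz z(2) by (metis mult_eq_0_iff of_real_eq_0_iff)
  ultimately show "sym_q_deriv q a z =
      (F (of_real q * z) - F (z / of_real q)) / ?c"
    by (simp add: sym_q_deriv_def)
qed

text \<open>The conjunct \<open>f z \<noteq> 0\<close> expresses that the quotient \<open>p\<close> is well defined.\<close>

definition ST_neg :: "real \<Rightarrow> real \<Rightarrow> real \<Rightarrow> (complex \<Rightarrow> complex) set" where
  "ST_neg k q \<alpha> = {f. f holomorphic_on ball 0 1 \<and>
     (\<exists>a. (\<forall>m\<ge>2. 0 \<le> a m) \<and> has_neg_expansion f a \<and> sym_q_deriv_converges q a \<and>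
        (\<forall>z\<in>ball 0 1 - {0}. f z \<noteq> 0) \<and>
        (\<forall>z\<in>ball 0 1.
           let p = (if z = 0 then 1 else z * sym_q_deriv q a z / f z)
           in Re p > k * norm (p - 1) + \<alpha>))}"

definition bohr_inequality :: "(complex \<Rightarrow> complex) \<Rightarrow> (nat \<Rightarrow> real) \<Rightarrow> complex \<Rightarrow> bool" where
  "bohr_inequality f a z \<longleftrightarrow>
     norm z + (\<Sum>m. a (m + 2) * norm z ^ (m + 2)) \<le> infdist (f 0) (frontier (f ` ball 0 1))"

definition bohr_radii :: "(complex \<Rightarrow> complex) set \<Rightarrow> real set" where
  "bohr_radii C = {R \<in> {0..1}. \<forall>f\<in>C. \<forall>a. has_neg_expansion f a \<longrightarrow>
     (\<forall>z\<in>ball 0 1. norm z \<le> R \<longrightarrow> bohr_inequality f a z)}"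

definition is_bohr_radius :: "(complex \<Rightarrow> complex) set \<Rightarrow> real \<Rightarrow> bool" where
  "is_bohr_radius C R \<longleftrightarrow> R \<in> bohr_radii C \<and> (\<forall>R'\<in>bohr_radii C. R' \<le> R)"

end

theory Submission
  imports Defs
begin

text \<open>Write \<open>[m]\<close> for the symmetric \<open>q\<close>-number. On a real radius \<open>z = r\<close> the function \<open>f\<close> is positive
  and \<open>p(r) \<le> 1\<close>, so the defining inequality becomes linear in the coefficients:
  \<open>\<Sum> ((k + 1) [m] - (k + \<alpha>)) a\<^sub>m r\<^bsup>m-1\<^esup> < 1 - \<alpha>\<close>. As the weights are smallest at \<open>m = 2\<close>, letting \<open>r \<rightarrow> 1\<close>
  yields \<open>\<Sum> a\<^sub>m \<le> A\<close>, hence \<open>|f(z) - z| \<le> A |z|\<^sup>2\<close>. By the open mapping theorem a boundary point of the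
  image is a limit of values \<open>f(z\<^sub>n)\<close> with \<open>|z\<^sub>n| \<rightarrow> 1\<close>, so its modulus is at least \<open>1 - A\<close>, and the radius
  solves \<open>\<rho> + A \<rho>\<^sup>2 = 1 - A\<close>. For \<open>z - A z\<^sup>2\<close>, which is injective on the closed disc because \<open>A < 1/2\<close>,
  the value \<open>1 - A\<close> at \<open>z = 1\<close> is a boundary point, so every bound is attained.\<close>

section \<open>Uniqueness of the coefficients and symmetric q-numbers\<close>

text \<open>The difference of two expansions is a power series vanishing on the disc, while a
  nonzero coefficient would make its zero at 0 isolated. Membership in \<open>ST_neg\<close>
  supplies only some coefficient sequence; this transfers its properties to any given
  expansion.\<close>

lemma has_neg_expansion_unique:
  assumes a: "has_neg_expansion f a" and b: "has_neg_expansion f b" and m: "m \<ge> 2"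
  shows "a m = b m"
proof (rule ccontr)
  assume ne: "a m \<noteq> b m"
  \<comment> \<open>An expansion does not determine its entries at 0 and 1, so these are set to 0;
    the shift by 2 then keeps the sum.\<close>
  define c :: "nat \<Rightarrow> complex" where "c = (\<lambda>n. if n < 2 then 0 else of_real (a n - b n))"
  have sums: "(\<lambda>n. c n * (x - 0) ^ n) sums 0" if "norm (x - 0) < 1" for x
  proof -
    have "(\<lambda>n. of_real (a (n + 2)) * x ^ (n + 2) - of_real (b (n + 2)) * x ^ (n + 2))
        sums ((x - f x) - (x - f x))"
      using a b that unfolding has_neg_expansion_def by (intro sums_diff) auto
    then have "(\<lambda>n. c (n + 2) * (x - 0) ^ (n + 2)) sums 0"
      by (simp add: c_def algebra_simps)
    then show ?thesis
      by (subst (asm) sums_zero_iff_shift) (auto simp: c_def)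
  qed
  have "c m \<noteq> 0" "m > 0" using ne m by (auto simp: c_def)
  then obtain s where s: "0 < s" "\<And>z. z \<in> cball (0::complex) s - {0} \<Longrightarrow> (\<lambda>_. 0::complex) z \<noteq> 0"
    using powser_0_nonzero[of 1 0 c "\<lambda>_. 0" m] sums by auto
  from s(2)[of "of_real s"] s(1) show False by simp
qed

lemma sym_q_number_2:
  assumes "0 < q" "q < 1"
  shows "sym_q_number q 2 = q + inverse q"
proof -
  have "inverse q > 1" using assms by (simp add: one_less_inverse)
  then have "q - inverse q \<noteq> 0" using assms by linarith
  then show ?thesis
    by (simp add: sym_q_number_def power2_eq_square square_diff_square_factored)
qed

lemma sym_q_number_2_gt:
  assumes "0 < q" "q < 1"
  shows "2 < sym_q_number q 2"
proof -
  have "0 < (1 - q)\<^sup>2 / q" using assms by simp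
  also have "\<dots> = q + inverse q - 2" using assms by (simp add: field_simps power2_eq_square)
  finally show ?thesis using sym_q_number_2[OF assms] by simp
qed

lemma sym_q_number_mono:
  assumes q: "0 < q" "q < 1" and "m \<le> n"
  shows "sym_q_number q m \<le> sym_q_number q n"
proof -
  have iq: "inverse q > 1" using q by (simp add: one_less_inverse)
  \<comment> \<open>Both differences change sign, which makes the denominator positive.\<close>
  have eq: "sym_q_number q j = (inverse q ^ j - q ^ j) / (inverse q - q)" for j
    unfolding sym_q_number_def by (metis minus_diff_eq minus_divide_divide)
  have "inverse q ^ m \<le> inverse q ^ n" using iq assms(3) by (intro power_increasing) auto
  moreover have "q ^ n \<le> q ^ m" using q assms(3) by (intro power_decreasing) auto
  ultimately show ?thesis unfolding eq using iq q by (intro divide_right_mono diff_mono) auto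
qed

section \<open>Coefficient bounds from real radii\<close>

text \<open>The sum is 0 at radius 0 and continuous in the radius, so it cannot reach 1 or more
  without taking the value 1. It is applied to f(x) = x (1 - s(x)), where s(x) = 1 would be a zero
  of f.\<close>

lemma real_powser_sum_less_1:
  fixes c :: "nat \<Rightarrow> real"
  assumes summ: "\<And>r. 0 \<le> r \<Longrightarrow> r < 1 \<Longrightarrow> summable (\<lambda>n. c n * r ^ Suc n)"
    and ne: "\<And>r. 0 < r \<Longrightarrow> r < 1 \<Longrightarrow> (\<Sum>n. c n * r ^ Suc n) \<noteq> 1"
    and r: "0 \<le> r" "r < 1"
  shows "(\<Sum>n. c n * r ^ Suc n) < 1"
proof (rule ccontr)
  define s where "s = (\<lambda>x::real. \<Sum>n. c n * x ^ Suc n)"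
  assume "\<not> ?thesis"
  then have ge: "1 \<le> s r" by (simp add: s_def)
  \<comment> \<open>Convergence at a point beyond \<open>r\<close> gives continuity on the whole of
    \<open>{0..r}\<close>.\<close>
  define K where "K = (r + 1) / 2"
  have K: "0 < K" "K < 1" "r < K" using r by (auto simp: K_def)
  have sK: "summable (\<lambda>n. c n * K ^ n)"
    using summable_mult[OF summ[of K], of "inverse K"] K by (simp add: field_simps)
  have eq: "s x = x * (\<Sum>n. c n * x ^ n)" if "0 \<le> x" "x \<le> r" for x
  proof -
    have "summable (\<lambda>n. c n * x ^ n)" 
      using powser_inside[OF sK, of x] that K by simp
    from suminf_mult[OF this, of x] show ?thesis by (simp add: s_def algebra_simps)
  qed
  have "continuous_on {0..r} (\<lambda>x. x * (\<Sum>n. c n * x ^ n))"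
    using K by (intro continuous_intros continuous_at_imp_continuous_on ballI isCont_powser[OF sK]) auto
  then have "continuous_on {0..r} s" by (rule continuous_on_eq) (auto simp: eq)
  moreover have "s 0 = 0" by (simp add: s_def)
  ultimately obtain x where x: "0 \<le> x" "x \<le> r" "s x = 1"
    using IVT'[of s 0 1 r] ge r by auto
  then have "x > 0" using \<open>s 0 = 0\<close> by (cases "x = 0") auto
  with ne[of x] x r show False by (simp add: s_def)
qed

text \<open>Let s and t be the sums of a_m r^(m-1) and [m] a_m r^(m-1) over m \<ge> 2. Then p(r) =
  (1 - t) / (1 - s) is real. Since s < 1 and s \<le> t, |p - 1| = 1 - p, and clearing the
  denominator leaves an inequality linear in s and t.\<close>

lemma ST_neg_weighted_sum_less:
  fixes k q \<alpha> r :: real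
  assumes k: "0 \<le> k" and q: "0 < q" "q < 1"
    and f: "f \<in> ST_neg k q \<alpha>" and a: "has_neg_expansion f a"
    and r: "0 < r" "r < 1"
  shows "summable (\<lambda>m. ((k + 1) * sym_q_number q (m + 2) - (k + \<alpha>)) * a (m + 2) * r ^ Suc m)"
    and "(\<Sum>m. ((k + 1) * sym_q_number q (m + 2) - (k + \<alpha>)) * a (m + 2) * r ^ Suc m) < 1 - \<alpha>"
    and "m \<ge> 2 \<Longrightarrow> 0 \<le> a m"
proof -
  obtain b where b: "\<forall>m\<ge>2. 0 \<le> b m" "has_neg_expansion f b" "sym_q_deriv_converges q b"
     "\<forall>z\<in>ball 0 1 - {0}. f z \<noteq> 0"
     "\<forall>z\<in>ball 0 1. let p = (if z = 0 then 1 else z * sym_q_deriv q b z / f z)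
           in Re p > k * norm (p - 1) + \<alpha>"
    using f unfolding ST_neg_def by auto
  have ab: "b m = a m" if "m \<ge> 2" for m using has_neg_expansion_unique[OF b(2) a that] .
  then show nonneg: "m \<ge> 2 \<Longrightarrow> 0 \<le> a m" for m using b(1) by auto
  define c where "c = (\<lambda>m. a (m + 2))"
  define d where "d = (\<lambda>m. sym_q_number q (m + 2) * a (m + 2))"
  have f_sums: "(\<lambda>m. complex_of_real (x * (c m * x ^ Suc m))) sums (of_real x - f (of_real x))"
    if "0 \<le> x" "x < 1" for x
    using a that unfolding has_neg_expansion_def c_def
    by (auto dest!: bspec[of _ _ "complex_of_real x"] simp: algebra_simps)
  have c_summ: "summable (\<lambda>m. c m * x ^ Suc m)" if "0 \<le> x" "x < 1" for x
  proof (cases "x = 0")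
    case False
    have "summable (\<lambda>m. x * (c m * x ^ Suc m))"
      using sums_summable[OF f_sums[OF that]] by (simp only: summable_of_real_iff)
    from summable_mult[OF this, of "inverse x"] False show ?thesis by (simp add: field_simps)
  qed auto
  define s where "s = (\<lambda>x. \<Sum>m. c m * x ^ Suc m)"
  have f_eq: "f (of_real x) = of_real (x * (1 - s x))" if "0 \<le> x" "x < 1" for x
  proof -
    have "(\<lambda>m. complex_of_real (x * (c m * x ^ Suc m))) sums of_real (x * s x)"
      unfolding s_def by (intro sums_of_real sums_mult summable_sums c_summ that)
    with f_sums[OF that] have "of_real x - f (of_real x) = of_real (x * s x)"
      by (rule sums_unique2)
    then show ?thesis by (simp add: algebra_simps)
  qed
  have "s r < 1" unfolding s_def
  proof (rule real_powser_sum_less_1)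
    show "(\<Sum>n. c n * x ^ Suc n) \<noteq> 1" if x: "0 < x" "x < 1" for x
    proof
      assume "(\<Sum>n. c n * x ^ Suc n) = 1"
      then have "f (of_real x) = 0" using f_eq[of x] x by (simp add: s_def)
      then show False using b(4) x by (auto dest!: bspec[of _ _ "complex_of_real x"])
    qed
  qed (use c_summ r in auto)
  have "summable (\<lambda>m. complex_of_real (d m * r ^ Suc m))"
    using b(3) r ab unfolding sym_q_deriv_converges_def d_def
    by (auto dest!: bspec[of _ _ "complex_of_real r"] simp: algebra_simps)
  then have d_summ: "summable (\<lambda>m. d m * r ^ Suc m)" by (simp only: summable_of_real_iff)
  define t where "t = (\<Sum>m. d m * r ^ Suc m)"
  have D_eq: "sym_q_deriv q b (of_real r) = of_real (1 - t)"
    using suminf_of_real[OF d_summ, where ?'a = complex] ab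
    by (simp add: sym_q_deriv_def t_def d_def algebra_simps)
  have "t - s r = (\<Sum>m. d m * r ^ Suc m - c m * r ^ Suc m)"
    unfolding t_def s_def using d_summ c_summ r by (intro suminf_diff) auto
  \<comment> \<open>For m \<ge> 2, [m] \<ge> [2] > 1 and a_m is nonnegative, so the terms of t
    dominate those of s.\<close>
  also have "\<dots> \<ge> 0"
  proof (intro suminf_nonneg summable_diff d_summ c_summ)
    fix m
    have "1 \<le> sym_q_number q (m + 2)"
      using sym_q_number_mono[OF q, of 2 "m + 2"] sym_q_number_2_gt[OF q] by simp
    then have "c m \<le> d m" using nonneg[of "m + 2"] mult_right_mono[of 1 _ "a (m + 2)"]
      by (simp add: c_def d_def)
    then show "0 \<le> d m * r ^ Suc m - c m * r ^ Suc m" using r by (simp add: mult_right_mono)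
  qed (use r in auto)
  finally have st: "s r \<le> t" by simp
  define p where "p = (1 - t) / (1 - s r)"
  have "complex_of_real r * sym_q_deriv q b (of_real r) / f (of_real r) = of_real p"
    unfolding D_eq p_def using f_eq[of r] r by simp
  with b(5) r have "p > k * norm (complex_of_real p - 1) + \<alpha>"
    by (auto dest!: bspec[of _ _ "complex_of_real r"] simp: Let_def)
  moreover have "norm (complex_of_real p - 1) = \<bar>p - 1\<bar>"
    by (metis norm_of_real of_real_1 of_real_diff)
  moreover have "p \<le> 1" unfolding p_def using st \<open>s r < 1\<close> by simp
  ultimately have "p > k * (1 - p) + \<alpha>" by simp
  then have "(k + 1) * p > k + \<alpha>" by (simp add: algebra_simps)
  then have "(k + 1) * p * (1 - s r) > (k + \<alpha>) * (1 - s r)" using \<open>s r < 1\<close> by simp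
  then have "(k + 1) * (1 - t) > (k + \<alpha>) * (1 - s r)" using \<open>s r < 1\<close> by (simp add: p_def)
  then have less: "(k + 1) * t - (k + \<alpha>) * s r < 1 - \<alpha>" by (simp add: algebra_simps)
  have "(\<lambda>m. (k + 1) * (d m * r ^ Suc m) - (k + \<alpha>) * (c m * r ^ Suc m))
      sums ((k + 1) * t - (k + \<alpha>) * s r)"
    unfolding t_def s_def using d_summ c_summ r by (intro sums_diff sums_mult summable_sums) auto
  then have *: "(\<lambda>m. ((k + 1) * sym_q_number q (m + 2) - (k + \<alpha>)) * a (m + 2) * r ^ Suc m)
      sums ((k + 1) * t - (k + \<alpha>) * s r)"
    by (simp add: c_def d_def algebra_simps)
  show "summable (\<lambda>m. ((k + 1) * sym_q_number q (m + 2) - (k + \<alpha>)) * a (m + 2) * r ^ Suc m)"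
    using * by (rule sums_summable)
  show "(\<Sum>m. ((k + 1) * sym_q_number q (m + 2) - (k + \<alpha>)) * a (m + 2) * r ^ Suc m) < 1 - \<alpha>"
    using sums_unique[OF *] less by simp
qed

text \<open>All weights are at least their value \<open>B\<close> at m = 2, and \<open>B\<close> > 0
  because [2] > 2. Bounding partial sums suffices, as the coefficients are nonnegative.\<close>

lemma ST_neg_coeffs:
  fixes k q \<alpha> :: real
  assumes k: "0 \<le> k" and q: "0 < q" "q < 1" and \<alpha>: "\<alpha> < 1"
    and f: "f \<in> ST_neg k q \<alpha>" and a: "has_neg_expansion f a"
  defines "B \<equiv> (k + 1) * sym_q_number q 2 - (k + \<alpha>)"
  shows "summable (\<lambda>m. a (m + 2))" and "(\<Sum>m. a (m + 2)) \<le> (1 - \<alpha>) / B"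
proof -
  define w where "w = (\<lambda>m. (k + 1) * sym_q_number q (m + 2) - (k + \<alpha>))"
  have nonneg: "0 \<le> a (m + 2)" for m
    using ST_neg_weighted_sum_less(3)[OF k q f a, of "1/2" "m + 2"] by simp
  have "(k + 1) * 2 \<le> (k + 1) * sym_q_number q 2"
    using k sym_q_number_2_gt[OF q] by (intro mult_left_mono) auto
  then have "0 < B" using k \<alpha> by (simp add: B_def)
  have wB: "B \<le> w m" for m
    unfolding B_def w_def using k sym_q_number_mono[OF q, of 2 "m + 2"] by (simp add: mult_left_mono)
  have bound: "(\<Sum>m<n. a (m + 2)) \<le> (1 - \<alpha>) / B" for n
  proof -
    \<comment> \<open>A partial sum is a polynomial in r, so r can tend to 1 without exchanging a
      limit with an infinite sum.\<close>
    have "((\<lambda>r. \<Sum>m<n. w m * a (m + 2) * r ^ Suc m) \<longlongrightarrow> (\<Sum>m<n. w m * a (m + 2) * 1 ^ Suc m))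
        (at_left (1::real))"
      by (intro tendsto_intros)
    moreover have "eventually (\<lambda>r::real. (\<Sum>m<n. w m * a (m + 2) * r ^ Suc m) \<le> 1 - \<alpha>) (at_left 1)"
      using eventually_at_left_real[OF zero_less_one]
    proof eventually_elim
      case (elim r)
      then have r: "0 < r" "r < 1" by auto
      have "(\<Sum>m<n. w m * a (m + 2) * r ^ Suc m) \<le> (\<Sum>m. w m * a (m + 2) * r ^ Suc m)"
        unfolding w_def
      proof (intro sum_le_suminf ST_neg_weighted_sum_less(1)[OF k q f a r] finite_lessThan)
        show "0 \<le> ((k + 1) * sym_q_number q (m + 2) - (k + \<alpha>)) * a (m + 2) * r ^ Suc m" for m
          using wB[of m] \<open>0 < B\<close> nonneg[of m] r unfolding w_def by simp
      qed
      also have "\<dots> < 1 - \<alpha>"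
        unfolding w_def by (rule ST_neg_weighted_sum_less(2)[OF k q f a r])
      finally show ?case by simp
    qed
    ultimately have "(\<Sum>m<n. w m * a (m + 2) * 1 ^ Suc m) \<le> 1 - \<alpha>"
      by (rule tendsto_upperbound) simp
    moreover have "(\<Sum>m<n. B * a (m + 2)) \<le> (\<Sum>m<n. w m * a (m + 2))"
      using wB nonneg by (intro sum_mono mult_right_mono) auto
    ultimately have "B * (\<Sum>m<n. a (m + 2)) \<le> 1 - \<alpha>" by (simp add: sum_distrib_left)
    then show ?thesis using \<open>0 < B\<close> by (simp add: field_simps)
  qed
  show "summable (\<lambda>m. a (m + 2))" using nonneg bound by (rule summableI_nonneg_bounded)
  then show "(\<Sum>m. a (m + 2)) \<le> (1 - \<alpha>) / B" using bound by (rule suminf_le_const)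
qed

section \<open>Growth and distance to the boundary\<close>

text \<open>Each power r^(m+2) is at most r^2. This serves both the growth estimate and the Bohr
  sum.\<close>

lemma power_series_tail_bound:
  fixes c :: "nat \<Rightarrow> real"
  assumes "\<And>m. 0 \<le> c m" "summable c" "(\<Sum>m. c m) \<le> A" "0 \<le> r" "r < 1"
  shows "summable (\<lambda>m. c m * r ^ (m + 2))" and "(\<Sum>m. c m * r ^ (m + 2)) \<le> A * r\<^sup>2"
proof -
  have le: "c m * r ^ (m + 2) \<le> c m * r\<^sup>2" for m
    using assms by (intro mult_left_mono power_decreasing) auto
  have s: "summable (\<lambda>m. c m * r\<^sup>2)" using assms(2) by (rule summable_mult2)
  show *: "summable (\<lambda>m. c m * r ^ (m + 2))"
    using assms le by (intro summable_comparison_test'[OF s, of 0]) auto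
  have "(\<Sum>m. c m * r ^ (m + 2)) \<le> (\<Sum>m. c m * r\<^sup>2)" using le * s by (rule suminf_le)
  also have "\<dots> = (\<Sum>m. c m) * r\<^sup>2" using assms(2) by (rule suminf_mult2[symmetric])
  finally show "(\<Sum>m. c m * r ^ (m + 2)) \<le> A * r\<^sup>2"
    using assms(3) by (meson mult_right_mono order_trans zero_le_power2)
qed

lemma neg_expansion_deviation:
  assumes a: "has_neg_expansion f a" and "\<And>m. 0 \<le> a (m + 2)" "summable (\<lambda>m. a (m + 2))"
    "(\<Sum>m. a (m + 2)) \<le> A" and z: "norm z < 1"
  shows "norm (z - f z) \<le> A * (norm z)\<^sup>2"
proof -
  have sums: "(\<lambda>m. of_real (a (m + 2)) * z ^ (m + 2)) sums (z - f z)"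
    using a z unfolding has_neg_expansion_def by simp
  have n: "norm (of_real (a (m + 2)) * z ^ (m + 2)) = a (m + 2) * norm z ^ (m + 2)" for m
    using assms(2)[of m] by (simp add: norm_mult norm_power)
  note t = power_series_tail_bound[of "\<lambda>m. a (m + 2)", OF assms(2-4) norm_ge_zero z]
  have "norm (\<Sum>m. of_real (a (m + 2)) * z ^ (m + 2)) \<le> (\<Sum>m. a (m + 2) * norm z ^ (m + 2))"
    using summable_norm[of "\<lambda>m. of_real (a (m + 2)) * z ^ (m + 2)"] t(1) unfolding n by simp
  then show ?thesis using t(2) sums_unique[OF sums] by simp
qed

text \<open>A boundary point w is a limit of values f(x_n), and |f(x_n)| \<ge> |x_n| - A |x_n|^2. By
  compactness some subsequence of x_n converges, and its limit must lie on the unit circle, where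
  the right-hand side tends to 1 - A.\<close>

lemma infdist_frontier_image_ge:
  fixes f :: "complex \<Rightarrow> complex"
  assumes hol: "f holomorphic_on ball 0 1" and A: "0 < A" "A < 1"
    and dev: "\<And>z. norm z < 1 \<Longrightarrow> norm (z - f z) \<le> A * (norm z)\<^sup>2"
  shows "1 - A \<le> infdist (f 0) (frontier (f ` ball 0 1))"
proof -
  have f0: "f 0 = 0" using dev[of 0] by simp
  have lower: "norm z - A * (norm z)\<^sup>2 \<le> norm (f z)" if "norm z < 1" for z
    using dev[OF that] norm_triangle_ineq2[of z "z - f z"] by simp
  have upper: "norm (f z) \<le> 1 + A" if "norm z < 1" for z
  proof -
    have "A * (norm z)\<^sup>2 \<le> A * 1\<^sup>2" using that A by (intro mult_left_mono power_mono) auto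
    then show ?thesis using dev[OF that] that norm_triangle_ineq2[of "f z" z]
      by (simp add: norm_minus_commute)
  qed
  \<comment> \<open>Boundedness makes the frontier nonempty; \<open>infdist\<close> to the empty set
    is 0 by convention and would break the bound.\<close>
  have bdd: "bounded (f ` ball 0 1)" unfolding bounded_iff using upper by (intro exI[of _ "1 + A"]) auto
  then have "f ` ball 0 1 \<noteq> UNIV" using not_bounded_UNIV by metis
  then have ne: "frontier (f ` ball 0 1) \<noteq> {}" using frontier_eq_empty[of "f ` ball 0 1"] by simp
  have "1 - A \<le> norm w" if w: "w \<in> frontier (f ` ball 0 1)" for w
  proof -
    \<comment> \<open>The open mapping theorem needs this; |f(1/2)| \<ge> 1/2 - A/4 > 0 =
      |f(0)|.\<close>
    have "\<not> f constant_on ball 0 1"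
    proof
      assume "f constant_on ball 0 1"
      then have "f (1/2) = f 0" by (auto simp: constant_on_def)
      then have "f (1/2) = 0" by (simp add: f0)
      with lower[of "1/2"] A show False by (simp add: power2_eq_square)
    qed
    then have "open (f ` ball 0 1)"
      using open_mapping_thm[OF hol _ _ _ subset_refl] by auto
    then have w_notin: "w \<notin> f ` ball 0 1" using w by (simp add: frontier_def interior_open)
    have "w \<in> closure (f ` ball 0 1)" using w by (simp add: frontier_def)
    then obtain y where y: "\<And>n. y n \<in> f ` ball 0 1" "y \<longlonglongrightarrow> w"
      unfolding closure_sequential by auto
    then obtain x where x: "\<And>n. x n \<in> ball 0 1" "\<And>n. y n = f (x n)"
      unfolding image_iff by metis
    have "compact (cball (0::complex) 1)" by simp
    moreover have "\<forall>n. x n \<in> cball 0 1" using x(1) ball_subset_cball by blast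
    ultimately obtain l \<phi> where l: "l \<in> cball 0 1" "strict_mono \<phi>" "(x \<circ> \<phi>) \<longlonglongrightarrow> l"
      unfolding compact_def by metis
    have fx: "(\<lambda>n. f (x (\<phi> n))) \<longlonglongrightarrow> w"
      using LIMSEQ_subseq_LIMSEQ[OF y(2) l(2)] x(2) by (simp add: o_def)
    have "norm l = 1"
    proof (rule ccontr)
      \<comment> \<open>An interior limit point would give w = f(l) by continuity, but the open
        image misses its own frontier.\<close>
      assume "norm l \<noteq> 1"
      then have lb: "l \<in> ball 0 1" using l(1) by simp
      have "isCont f l" using holomorphic_on_imp_continuous_on[OF hol] lb
        by (simp add: continuous_on_eq_continuous_at)
      then have "(\<lambda>n. f (x (\<phi> n))) \<longlonglongrightarrow> f l"
        using isCont_tendsto_compose[OF _ l(3)] by (simp add: o_def)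
      then have "w = f l" using fx LIMSEQ_unique by blast
      then show False using w_notin lb by blast
    qed
    \<comment> \<open>No continuity of f at l on the circle is available, so the lower bound itself
      is passed to the limit.\<close>
    moreover have "(\<lambda>n. norm (x (\<phi> n)) - A * (norm (x (\<phi> n)))\<^sup>2) \<longlonglongrightarrow> norm l - A * (norm l)\<^sup>2"
      using l(3) unfolding o_def by (intro tendsto_intros)
    then have "norm l - A * (norm l)\<^sup>2 \<le> norm w"
      by (rule tendsto_le[OF sequentially_bot tendsto_norm[OF fx]])
        (use lower x(1) in \<open>auto intro!: always_eventually\<close>)
    ultimately show ?thesis by simp
  qed
  then show ?thesis unfolding f0 infdist_def using ne
    by (auto intro!: cINF_greatest)
qed

section \<open>The extremal quadratic\<close>

lemma has_neg_expansion_quadratic: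
  "has_neg_expansion (\<lambda>z. z - of_real A * z\<^sup>2) (\<lambda>m. if m = 2 then A else 0)"
  unfolding has_neg_expansion_def
proof
  fix z :: complex
  have "(\<lambda>m. complex_of_real (if m + 2 = 2 then A else 0) * z ^ (m + 2)) sums
      (\<Sum>m\<in>{0}. complex_of_real (if m + 2 = 2 then A else 0) * z ^ (m + 2))"
    by (rule sums_finite) auto
  then show "(\<lambda>m. complex_of_real (if m + 2 = 2 then A else 0) * z ^ (m + 2)) sums
      (z - (z - of_real A * z\<^sup>2))"
    by (simp add: power2_eq_square)
qed

text \<open>As 1 - Re p \<le> |p - 1|, it is enough that (k + 1) |p - 1| < 1 - \<alpha>. Here p - 1
  = -([2] - 1) A z / (1 - A z), and \<open>A_eq\<close> makes this estimate just hold for |z| <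
  1.\<close>

lemma quadratic_in_ST_neg:
  fixes k q \<alpha> A :: real
  assumes k: "0 \<le> k" and A: "0 < A" "A < 1"
    and q: "0 < q" "q < 1"
    and A_eq: "A * ((k + 1) * sym_q_number q 2 - (k + \<alpha>)) = 1 - \<alpha>"
  shows "(\<lambda>z. z - of_real A * z\<^sup>2) \<in> ST_neg k q \<alpha>"
proof -
  define c where "c = sym_q_number q 2"
  define b where "b = (\<lambda>m::nat. if m = 2 then A else 0)"
  have c: "c > 2" unfolding c_def by (rule sym_q_number_2_gt[OF q])
  have D_sums: "(\<lambda>m. of_real (sym_q_number q (m + 2) * b (m + 2)) * z ^ (m + 1)) sums (of_real (c * A) * z)"
    for z :: complex
    using sums_finite[of "{0}" "\<lambda>m. of_real (sym_q_number q (m + 2) * b (m + 2)) * z ^ (m + 1)"]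
    by (simp add: b_def c_def numeral_2_eq_2)
  have D: "sym_q_deriv q b z = 1 - of_real (c * A) * z" for z
    unfolding sym_q_deriv_def using sums_unique[OF D_sums[of z]] by simp
  have bnd: "norm (of_real A * z) = A * norm z" for z :: complex using A by (simp add: norm_mult)
  have denom: "0 < 1 - A * norm z" "1 - A * norm z \<le> norm (1 - of_real A * z)" if "norm z < 1" for z :: complex
  proof -
    show "0 < 1 - A * norm z" using A that mult_strict_mono'[of A 1 "norm z" 1] by simp
    show "1 - A * norm z \<le> norm (1 - of_real A * z)"
      using norm_triangle_ineq2[of 1 "of_real A * z"] bnd[of z] by simp
  qed
  have ne: "1 - of_real A * z \<noteq> 0" if "norm z < 1" for z :: complex
    using denom[OF that] by auto
  have f_eq: "z - of_real A * z\<^sup>2 = z * (1 - of_real A * z)" for z :: complex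
    by (simp add: power2_eq_square algebra_simps)
  have "let p = (if z = 0 then 1 else z * sym_q_deriv q b z / (z - of_real A * z\<^sup>2))
           in Re p > k * norm (p - 1) + \<alpha>" if z: "norm z < 1" for z
  proof -
    define p where "p = (if z = 0 then 1 else z * sym_q_deriv q b z / (z - of_real A * z\<^sup>2))"
    \<comment> \<open>Cancelling z also covers z = 0, where the quotient has the prescribed value
      1.\<close>
    have p: "p = (1 - of_real (c * A) * z) / (1 - of_real A * z)"
      unfolding p_def D f_eq by simp
    have "p - 1 = - of_real ((c - 1) * A) * z / (1 - of_real A * z)"
      unfolding p using ne[OF z] by (simp add: field_simps)
    then have "norm (p - 1) = (c - 1) * A * norm z / norm (1 - of_real A * z)"
      using c A by (simp add: norm_mult norm_divide abs_mult del: of_real_mult of_real_diff)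
    also have "\<dots> \<le> (c - 1) * A * norm z / (1 - A * norm z)"
      using denom[OF z] c A by (intro divide_left_mono mult_pos_pos) (auto intro: less_le_trans)
    finally have "(k + 1) * norm (p - 1) \<le> (k + 1) * ((c - 1) * A * norm z / (1 - A * norm z))"
      using k by (intro mult_left_mono) auto
    also have "\<dots> < 1 - \<alpha>"
    proof -
      \<comment> \<open>This is \<open>A_eq\<close> with (k + 1) c - (k + \<alpha>) split as (k + 1)
        (c - 1) + (1 - \<alpha>); multiplied by |z| < 1 it gives the required strict
        inequality.\<close>
      have eq: "(k + 1) * ((c - 1) * A) + (1 - \<alpha>) * A = 1 - \<alpha>"
        using A_eq by (simp add: c_def algebra_simps)
      have "0 < (k + 1) * ((c - 1) * A)" using k c A by simp
      then have "0 < (1 - \<alpha>) * (1 - A)" using eq by (simp add: algebra_simps)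
      then have "0 < 1 - \<alpha>" using A by (simp add: zero_less_mult_iff)
      then have "(1 - \<alpha>) * norm z < 1 - \<alpha>" using z by simp
      moreover have "((k + 1) * ((c - 1) * A) + (1 - \<alpha>) * A) * norm z = (1 - \<alpha>) * norm z"
        unfolding eq ..
      ultimately have "(k + 1) * ((c - 1) * A * norm z) < (1 - \<alpha>) * (1 - A * norm z)"
        by (simp add: algebra_simps)
      then show ?thesis using denom(1)[OF z] by (simp add: pos_divide_less_eq)
    qed
    finally have "(k + 1) * norm (p - 1) < 1 - \<alpha>" .
    moreover have "1 - Re p \<le> norm (p - 1)"
      using complex_Re_le_cmod[of "1 - p"] by (simp add: norm_minus_commute)
    ultimately have "Re p > k * norm (p - 1) + \<alpha>" by (simp add: algebra_simps)
    then show ?thesis unfolding p_def[symmetric] by (simp add: Let_def)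
  qed
  moreover have "(\<lambda>z. z - of_real A * z\<^sup>2) holomorphic_on ball 0 1" by (intro holomorphic_intros)
  moreover have "\<forall>m\<ge>2. 0 \<le> b m" using A by (simp add: b_def)
  moreover have "sym_q_deriv_converges q b"
    unfolding sym_q_deriv_converges_def using D_sums sums_summable by blast
  moreover have "\<forall>z\<in>ball 0 1 - {0}. z - complex_of_real A * z\<^sup>2 \<noteq> 0"
  proof
    fix z :: complex
    assume "z \<in> ball 0 1 - {0}"
    then show "z - of_real A * z\<^sup>2 \<noteq> 0" unfolding f_eq using ne[of z] by simp
  qed
  ultimately show ?thesis
    using has_neg_expansion_quadratic[of A] unfolding ST_neg_def b_def[symmetric] mem_Collect_eq
    by (intro conjI exI[of _ b] ballI) simp_all
qed

text \<open>The value 1 - A at z = 1 lies in the closure of the image but not in the image, hence on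
  the frontier.\<close>

lemma infdist_frontier_quadratic:
  assumes A: "0 < A" "A < 1/2"
  shows "infdist 0 (frontier ((\<lambda>z::complex. z - of_real A * z\<^sup>2) ` ball 0 1)) \<le> 1 - A"
proof -
  let ?f = "\<lambda>z::complex. z - of_real A * z\<^sup>2"
  have "continuous_on UNIV ?f" by (intro continuous_intros)
  then have "?f ` closure (ball 0 1) \<subseteq> closure (?f ` ball 0 1)"
    by (meson closure_subset continuous_on_subset image_closure_subset subset_UNIV closed_closure)
  moreover have "of_real (1 - A) \<in> ?f ` closure (ball 0 1)" by (intro image_eqI[of _ _ 1]) auto
  ultimately have cl: "of_real (1 - A) \<in> closure (?f ` ball 0 1)" by blast
  have "of_real (1 - A) \<notin> ?f ` ball 0 1"
  proof
    assume "of_real (1 - A) \<in> ?f ` ball 0 1"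
    then obtain z where z: "norm z < 1" "of_real (1 - A) = ?f z" by auto
    \<comment> \<open>Factorization of f(1) - f(z); the second factor cannot vanish because |A (1 +
      z)| < 1 when A < 1/2.\<close>
    then have "(1 - z) * (1 - of_real A * (1 + z)) = 0"
      by (simp add: power2_eq_square algebra_simps)
    moreover have "1 - z \<noteq> 0" using z by auto
    ultimately have "of_real A * (1 + z) = 1" by simp
    then have "A * norm (1 + z) = 1" using A by (metis abs_of_pos norm_mult norm_of_real norm_one)
    moreover have "norm (1 + z) < 2" using norm_triangle_ineq[of 1 z] z by simp
    then have "A * norm (1 + z) < (1/2) * 2" using A by (intro mult_strict_mono) auto
    ultimately show False by simp
  qed
  then have "of_real (1 - A) \<in> frontier (?f ` ball 0 1)"
    using cl interior_subset unfolding frontier_def by blast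
  from infdist_le[OF this, of 0] show ?thesis using A
    by (simp add: dist_norm del: of_real_diff)
qed

section \<open>The sharp radius\<close>

text \<open>Beyond \<open>\<rho>\<close> the quadratic violates the inequality, since x + A x^2 is
  strictly increasing for x > 0. The class \<open>C\<close> is kept general to cover both the full
  class and the singleton of the quadratic.\<close>

lemma is_bohr_radiusI:
  assumes "0 < A" "A < 1" "0 < \<rho>" "\<rho> < 1" "\<rho> + A * \<rho>\<^sup>2 = 1 - A"
    and C: "\<And>f a z. f \<in> C \<Longrightarrow> has_neg_expansion f a \<Longrightarrow> norm z \<le> \<rho> \<Longrightarrow> bohr_inequality f a z"
    and mem: "(\<lambda>z. z - of_real A * z\<^sup>2) \<in> C"
    and dist: "infdist 0 (frontier ((\<lambda>z::complex. z - of_real A * z\<^sup>2) ` ball 0 1)) \<le> 1 - A"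
  shows "is_bohr_radius C \<rho>"
  unfolding is_bohr_radius_def
proof (intro conjI ballI)
  show "\<rho> \<in> bohr_radii C" using assms unfolding bohr_radii_def by auto
  fix R assume R: "R \<in> bohr_radii C"
  show "R \<le> \<rho>"
  proof (rule ccontr)
    assume "\<not> R \<le> \<rho>"
    \<comment> \<open>The midpoint stays below 1 even if \<open>R\<close> is 1, as the inequality is
      only demanded in the open disc.\<close>
    define x where "x = (\<rho> + R) / 2"
    have x: "\<rho> < x" "x \<le> R" "x < 1" "0 < x"
      using \<open>\<not> R \<le> \<rho>\<close> R assms(3,4) by (auto simp: x_def bohr_radii_def)
    have norm_x: "norm (complex_of_real x) = x" using x by simp
    have "bohr_inequality (\<lambda>z. z - of_real A * z\<^sup>2) (\<lambda>m. if m = 2 then A else 0) (of_real x)"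
      using R mem has_neg_expansion_quadratic[of A] x norm_x unfolding bohr_radii_def
      by (simp del: norm_of_real)
    moreover have "(\<Sum>m. (if m + 2 = 2 then A else 0) * x ^ (m + 2)) = A * x\<^sup>2"
      by (subst suminf_finite[of "{0}"]) (auto simp: power2_eq_square)
    ultimately have "x + A * x\<^sup>2 \<le> 1 - A"
      using dist unfolding bohr_inequality_def norm_x by simp
    moreover have "A * \<rho>\<^sup>2 < A * x\<^sup>2" 
      using x assms by (intro mult_strict_left_mono power_strict_mono) auto
    ultimately show False using x assms(5) by simp
  qed
qed

text \<open>\<open>\<rho>\<close> is the positive root of A x^2 + x = 1 - A, the equality case of
  the Bohr inequality for the quadratic.\<close>

lemma quadratic_root:
  fixes A \<rho> :: real
  assumes A: "0 < A" "A < 1" and \<rho>: "\<rho> = (- 1 + sqrt (1 + 4 * A * (1 - A))) / (2 * A)"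
  shows "0 < \<rho>" "\<rho> < 1" "\<rho> + A * \<rho>\<^sup>2 = 1 - A"
proof -
  define s where "s = sqrt (1 + 4 * A * (1 - A))"
  have s2: "s\<^sup>2 = 1 + 4 * A * (1 - A)" unfolding s_def using A by (intro real_sqrt_pow2) simp
  have "1 < s" unfolding s_def using A by simp
  have s: "s = 2 * A * \<rho> + 1" unfolding \<rho> s_def using A by simp
  show pos: "0 < \<rho>" using \<open>1 < s\<close> A unfolding s by (simp add: zero_less_mult_iff)
  have "4 * A * (\<rho> + A * \<rho>\<^sup>2) = 4 * A * (1 - A)"
    using s2 unfolding s by (simp add: power2_eq_square algebra_simps)
  then show eq: "\<rho> + A * \<rho>\<^sup>2 = 1 - A" using A by simp
  have "0 \<le> A * \<rho>\<^sup>2" using A by simp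
  with eq A show "\<rho> < 1" by linarith
qed

theorem theorem2p9:
  fixes k q \<alpha> A rstar :: real and f :: "complex \<Rightarrow> complex" and a :: "nat \<Rightarrow> real"
  assumes k: "0 \<le> k" and q: "0 < q" "q < 1" and \<alpha>: "0 \<le> \<alpha>" "\<alpha> < 1"
    and A: "A = q * (1 - \<alpha>) / ((q\<^sup>2 + 1) * (k + 1) - q * (k + \<alpha>))"
    and rstar: "rstar = (- 1 + sqrt (1 + 4 * A * (1 - A))) / (2 * A)"
    and f: "f \<in> ST_neg k q \<alpha>"
    and a: "has_neg_expansion f a"
  shows "(\<forall>(z::complex) r. norm z = r \<and> r < 1 \<longrightarrow>
            r - A * r\<^sup>2 \<le> norm (f z) \<and> norm (f z) \<le> r + A * r\<^sup>2) \<and>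
         (\<forall>z::complex. norm z \<le> rstar \<longrightarrow> 
            norm z + (\<Sum>m. a (m + 2) * norm z ^ (m + 2)) \<le> infdist (f 0) (frontier (f ` ball 0 1))) \<and>
         is_bohr_radius (ST_neg k q \<alpha>) rstar \<and>
         (let f\<^sub>0 = (\<lambda>z. z - of_real A * z\<^sup>2)
          in f\<^sub>0 \<in> ST_neg k q \<alpha> \<and> is_bohr_radius {f\<^sub>0} rstar \<and>
             (\<forall>z::complex. norm z = rstar \<longrightarrow>
                norm z + A * (norm z)\<^sup>2 = infdist (f\<^sub>0 0) (frontier (f\<^sub>0 ` ball 0 1))))"
proof -
  define c where "c = sym_q_number q 2"
  define B where "B = (k + 1) * c - (k + \<alpha>)"
  let ?f0 = "\<lambda>z::complex. z - of_real A * z\<^sup>2"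
  have "2 < c" unfolding c_def by (rule sym_q_number_2_gt[OF q])
  \<comment> \<open>It follows that B > k + 2 - \<alpha> \<ge> 2 (1 - \<alpha>), which is the source
    of A < 1/2.\<close>
  have "(k + 1) * 2 < (k + 1) * c" using k \<open>2 < c\<close> by (intro mult_strict_left_mono) auto
  then have B: "2 * (1 - \<alpha>) < B" "0 < B"
    using k \<alpha> by (auto simp: B_def algebra_simps)
  \<comment> \<open>Because q [2] = q^2 + 1, the given denominator is q times the weight at m =
    2.\<close>
  have "(q\<^sup>2 + 1) * (k + 1) - q * (k + \<alpha>) = q * B"
    using q by (simp add: B_def c_def sym_q_number_2 field_simps power2_eq_square)
  then have A_eq: "A = (1 - \<alpha>) / B" using A q by simp
  then have AB: "A * B = 1 - \<alpha>" using B by simp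
  have A01: "0 < A" "A < 1/2" "A < 1"
    unfolding A_eq using B \<alpha> by (simp_all add: divide_less_eq)
  note \<rho> = quadratic_root[OF A01(1,3) rstar]
  have nonneg: "0 \<le> b (m + 2)" and summ: "summable (\<lambda>m. b (m + 2))" "(\<Sum>m. b (m + 2)) \<le> A"
    if "g \<in> ST_neg k q \<alpha>" "has_neg_expansion g b" for g b m
    using ST_neg_weighted_sum_less(3)[OF k q that, of "1/2" "m + 2"]
      ST_neg_coeffs[OF k q \<alpha>(2) that] by (simp_all add: A_eq B_def c_def)
  have dev: "norm (z - g z) \<le> A * (norm z)\<^sup>2"
    if "g \<in> ST_neg k q \<alpha>" "has_neg_expansion g b" "norm z < 1" for g b z
    using neg_expansion_deviation[OF that(2) _ _ _ that(3)] nonneg[OF that(1,2)] summ[OF that(1,2)]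
    by blast
  have dist: "1 - A \<le> infdist (g 0) (frontier (g ` ball 0 1))"
    if "g \<in> ST_neg k q \<alpha>" "has_neg_expansion g b" for g b
    using infdist_frontier_image_ge[OF _ A01(1,3) dev[OF that]] that(1) by (auto simp: ST_neg_def)
  have bohr: "bohr_inequality g b z"
    if g: "g \<in> ST_neg k q \<alpha>" "has_neg_expansion g b" and z: "norm z \<le> rstar" for g b z
  proof -
    have "(\<Sum>m. b (m + 2) * norm z ^ (m + 2)) \<le> A * (norm z)\<^sup>2"
      using power_series_tail_bound(2)[of "\<lambda>m. b (m + 2)" A "norm z"] nonneg[OF g] summ[OF g] z \<rho>(2)
      by simp
    also have "\<dots> \<le> A * rstar\<^sup>2" using z A01 by (intro mult_left_mono power_mono) auto
    finally show ?thesis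
      unfolding bohr_inequality_def using z \<rho>(3) dist[OF g] by linarith
  qed
  have f0: "?f0 \<in> ST_neg k q \<alpha>"
    using quadratic_in_ST_neg[OF k A01(1,3) q] AB by (simp add: B_def c_def)
  note f0_dist = infdist_frontier_quadratic[OF A01(1,2)]
  \<comment> \<open>Membership in the class gives the lower bound, the boundary point 1 - A the
    upper one.\<close>
  have f0_eq: "infdist (?f0 0) (frontier (?f0 ` ball 0 1)) = 1 - A"
    using dist[OF f0 has_neg_expansion_quadratic] f0_dist by simp
  have growth: "norm z - A * (norm z)\<^sup>2 \<le> norm (f z)" "norm (f z) \<le> norm z + A * (norm z)\<^sup>2"
    if "norm z < 1" for z
    using dev[OF f a that] norm_triangle_ineq2[of z "z - f z"] norm_triangle_ineq2[of "f z" z]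
    by (simp_all add: norm_minus_commute)
  show ?thesis unfolding Let_def
  proof (intro conjI)
    show "\<forall>(z::complex) r. norm z = r \<and> r < 1 \<longrightarrow>
            r - A * r\<^sup>2 \<le> norm (f z) \<and> norm (f z) \<le> r + A * r\<^sup>2"
      using growth by blast
    show "\<forall>z::complex. norm z \<le> rstar \<longrightarrow> 
            norm z + (\<Sum>m. a (m + 2) * norm z ^ (m + 2)) \<le> infdist (f 0) (frontier (f ` ball 0 1))"
      using bohr[OF f a] unfolding bohr_inequality_def by blast
    show "is_bohr_radius (ST_neg k q \<alpha>) rstar"
      using is_bohr_radiusI[OF A01(1,3) \<rho> _ f0 f0_dist] bohr by blast
    show "is_bohr_radius {?f0} rstar"
      using is_bohr_radiusI[OF A01(1,3) \<rho> _ singletonI f0_dist] bohr f0 by blast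
    show "\<forall>z::complex. norm z = rstar \<longrightarrow>
        norm z + A * (norm z)\<^sup>2 = infdist (?f0 0) (frontier (?f0 ` ball 0 1))"
      using f0_eq \<rho>(3) by simp
  qed (rule f0)
qed

end
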